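(* Fix $m\ge1$ and constants $\Delta>0$, $\eta>0$. Let $A\in\mathbb{C}^{m\times m}$ range over matrices such that $$\sigma(A)\subset\Big\{\lambda\in\mathbb{C}:\lambda\ne0,\ |\arg\lambda|\le\frac{\pi}{2}-\Delta\Big\}\qquad\text{and}\qquad \mu(A)\ge\eta\,\omega(A).$$ Assume that: (a) $f$ is a locally integrable function on $[0,\infty)$ and admits the (convergent) expansion $$f(t)=\sum_{n=1}^\infty a_n t^{n/r-1},\qquad 0<t\le c+\delta,$$ where $r$, $c$ and $\delta$ are positive; (b) there exist positive constants $M_0$ and $b$ independent of $t$ such that $|f(t)|<M_0\mathrm{e}^{bt}$ for all $t\ge c$. Then $$\int_0^\infty f(t)\mathrm{e}^{-tA}\,\mathrm{d}t\sim\sum_{n=1}^\infty a_n\Gamma(n/r)A^{-n/r},\qquad\text{as }\|A^{-1}\|\to0.$$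
   Context: For $A\in\mathbb{C}^{m\times m}$, $\sigma(A)$ is the set of eigenvalues, $A^H$ the conjugate transpose, $A^+:=\frac12(A+A^H)$, $\|A\|=\sup_{\|x\|_2=1}\|Ax\|_2$ the spectral norm, $$\mu(A)=\min\sigma(A^+),\qquad \omega(A)=\min\{\Re(\lambda):\lambda\in\sigma(A)\}.$$ For $\beta>0$, $A^{-\beta}:=\frac{1}{\Gamma(\beta)}\int_0^\infty t^{\beta-1}\mathrm{e}^{-tA}\,\mathrm{d}t$. The asymptotic expansion $F(A)\sim\sum_{n\ge1}d_nA^{-n/r}$ as $\|A^{-1}\|\to0$ means: for each integer $N\ge1$, $$\Big\|F(A)-\sum_{n=1}^{N}d_nA^{-n/r}\Big\|=o\big(\|A^{-N/r}\|\big)\quad\text{as }\|A^{-1}\|\to0,$$ uniformly over the admissible matrices $A$ (with $\Delta,\eta$ fixed), i.e. for every $\varepsilon>0$ there is $\rho>0$ such that the left side is at most $\varepsilon\|A^{-N/r}\|$ for all admissible $A$ with $\|A^{-1}\|<\rho$. *)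

theory Defs
  imports "HOL-Analysis.Analysis"
begin

definition spec :: "complex^'m^'m \<Rightarrow> complex set" where
  "spec A = {z. \<exists>v. v \<noteq> 0 \<and> A *v v = z *s v}"

definition conj_transpose :: "complex^'m^'m \<Rightarrow> complex^'m^'m" where
  "conj_transpose A = map_matrix cnj (transpose A)"

definition herm_part :: "complex^'m^'m \<Rightarrow> complex^'m^'m" where
  "herm_part A = (1/2) *\<^sub>R (A + conj_transpose A)"

text \<open>The norm on \<^typ>\<open>complex^'m\<close> is the Euclidean one, so this is the operator norm
  induced by it. The library norm of a matrix is instead the Frobenius norm.\<close>

definition spectral_norm :: "complex^'m^'m \<Rightarrow> real" where
  "spectral_norm A = onorm ((*v) A)"

text \<open>The eigenvalues of the Hermitian part are real; \<open>mu\<close> is the least of them as a real number.\<close>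

definition mu :: "complex^'m^'m \<Rightarrow> real" where
  "mu A = Min {x. complex_of_real x \<in> spec (herm_part A)}"

definition omega :: "complex^'m^'m \<Rightarrow> real" where
  "omega A = Min (Re ` spec A)"

definition cscale :: "complex \<Rightarrow> complex^'m^'m \<Rightarrow> complex^'m^'m" where
  "cscale z A = map_matrix ((*) z) A"

primrec mat_pow :: "complex^'m^'m \<Rightarrow> nat \<Rightarrow> complex^'m^'m" where
  "mat_pow A 0 = mat 1"
| "mat_pow A (Suc k) = A ** mat_pow A k"

text \<open>The library's \<^const>\<open>exp\<close> is not available here: multiplication in the type class
  instance on vectors is componentwise.\<close>

definition mat_exp :: "complex^'m^'m \<Rightarrow> complex^'m^'m" where
  "mat_exp A = (\<Sum>k. (1 / fact k) *\<^sub>R mat_pow A k)"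

text \<open>\<open>mat_neg_power A \<beta>\<close> is the power of \<open>A\<close> with exponent \<open>-\<beta>\<close>, for \<open>\<beta> > 0\<close>.\<close>

definition mat_neg_power :: "complex^'m^'m \<Rightarrow> real \<Rightarrow> complex^'m^'m" where
  "mat_neg_power A \<beta> =
     (1 / Gamma \<beta>) *\<^sub>R integral {0..} (\<lambda>t. t powr (\<beta> - 1) *\<^sub>R mat_exp ((-t) *\<^sub>R A))"

definition admissible :: "real \<Rightarrow> real \<Rightarrow> (complex^'m^'m) set" where
  "admissible \<Delta> \<eta> =
     {A. spec A \<subseteq> {z. z \<noteq> 0 \<and> \<bar>Arg z\<bar> \<le> pi / 2 - \<Delta>} \<and> mu A \<ge> \<eta> * omega A}"

text \<open>The expansion of \<open>F A\<close> in the terms \<open>d n\<close> times \<open>A\<close> to the power \<open>-n/r\<close> (\<open>n \<ge> 1\<close>),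
  as the norm of the inverse of \<open>A\<close> tends to zero, uniformly for \<open>A\<close> in \<open>S\<close>; the value \<open>d 0\<close> plays no role.\<close>

definition has_inverse_power_expansion ::
  "(complex^'m^'m \<Rightarrow> complex^'m^'m) \<Rightarrow> (nat \<Rightarrow> complex) \<Rightarrow> real \<Rightarrow> (complex^'m^'m) set \<Rightarrow> bool"
  where
  "has_inverse_power_expansion F d r S \<longleftrightarrow>
     (\<forall>N\<ge>1. \<forall>\<epsilon>>0. \<exists>\<rho>>0. \<forall>A\<in>S. spectral_norm (matrix_inv A) < \<rho> \<longrightarrow>
        spectral_norm (F A - (\<Sum>n=1..N. cscale (d n) (mat_neg_power A (real n / r))))
          \<le> \<epsilon> * spectral_norm (mat_neg_power A (real N / r)))"

end

theory Submission
  imports Defs "HOL-Complex_Analysis.Conformal_Mappings"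
begin

unbundle no fps_syntax

text \<open>
  The whole argument is a comparison of powers of \<open>\<omega> = omega A\<close>. Let \<open>R\<close> be the remainder of \<open>f\<close> after \<open>N\<close> terms
  of its expansion and \<open>\<gamma> = (N + 1) / r\<close>. Each term of \<open>f\<close> integrates exactly to the corresponding term of the
  asymptotic expansion, so the error is the integral of \<open>R t\<close> against \<open>exp (- t A)\<close>.

  Upper bound for the error. The series converges beyond \<open>c\<close>, which makes its tail of order
  \<open>t powr (\<gamma> - 1)\<close> on \<open>(0, c]\<close>, and the growth condition takes care of larger \<open>t\<close>; together they give
  \<open>norm (R t) \<le> C * t powr (\<gamma> - 1) * exp ((b + 1) * t)\<close> for all \<open>t > 0\<close> (\<open>remainder_bound\<close>). An energy
  estimate shows that the spectral norm of \<open>exp (- t A)\<close> is at most \<open>exp (- mu A * t)\<close> (\<open>norm_mat_exp_le\<close>).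
  The error is therefore at most \<open>C * Gamma \<gamma> / (mu A - (b + 1)) powr \<gamma>\<close> (\<open>expansion_error_le\<close>). As
  \<open>mu A \<ge> \<eta> * \<omega>\<close>, this is of order \<open>\<omega> powr (- \<gamma>)\<close> once \<open>\<omega>\<close> is large.

  Lower bound for the comparison term. Let \<open>z\<close> be an eigenvalue with \<open>Re z = \<omega>\<close>. Its eigenvector is mapped by
  the power of \<open>A\<close> with exponent \<open>- N / r\<close> to \<open>z powr (- N / r)\<close> times itself, because the Gamma integral extends
  to complex rates by analytic continuation (\<open>has_integral_Gamma_complex_rate\<close>). The sector condition gives
  \<open>norm z \<le> \<omega> / sin \<Delta>\<close>, so the norm of that power is at least a constant times \<open>\<omega> powr (- N / r)\<close>
  (\<open>spectral_norm_mat_neg_power_ge\<close>, \<open>admissible_eigenvalue\<close>).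

  The quotient is of order \<open>\<omega> powr (- 1 / r)\<close> with constants independent of \<open>A\<close>, and it tends to \<open>0\<close> because
  \<open>\<omega>\<close> is at least \<open>sin \<Delta>\<close> divided by the norm of the inverse (\<open>omega_gt_of_small_inverse\<close>).
\<close>


section \<open>Spectrum and numerical range\<close>

lemma poly_det:
  fixes M :: "complex poly^'m^'m"
  shows "poly (det M) z = det (\<chi> i j. poly (M $ i $ j) z)"
  by (simp add: det_def poly_sum poly_prod)

lemma mat_mult_vec: "mat (z::complex) *v v = z *s v"
  by (simp add: vec_eq_iff matrix_vector_mult_def mat_def if_distrib[where f="\<lambda>x. x * _"] cong: if_cong)

lemma mat_mult_entry: "(mat (z::complex) ** B) $ i $ j = z * B $ i $ j"
  by (simp add: matrix_matrix_mult_def mat_def if_distrib[where f="\<lambda>x. x * _"] cong: if_cong)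

lemma spec_iff_det: "z \<in> spec A \<longleftrightarrow> det (mat z - A) = 0"
proof -
  have "z \<in> spec A \<longleftrightarrow> (\<exists>v. v \<noteq> 0 \<and> (mat z - A) *v v = 0)"
    by (auto simp: spec_def matrix_vector_mult_diff_rdistrib mat_mult_vec)
  also have "\<dots> \<longleftrightarrow> \<not> invertible (mat z - A)"
    by (auto simp: invertible_left_inverse matrix_left_invertible_ker)
  finally show ?thesis by (simp add: invertible_det_nz)
qed

text \<open>Finiteness is what bounds the minimum in \<^const>\<open>mu\<close> by each real eigenvalue, and together with nonemptiness
it makes the minimum in \<^const>\<open>omega\<close> attained.
The spectrum is the root set of the characteristic polynomial \<open>p\<close>. That \<open>p\<close> is not constant is read off
from the reversed polynomial \<open>q w = det (1 - w A) = w ^ m * p (1 / w)\<close>: a constant \<open>p\<close> would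
force \<open>q w\<close> to tend to \<open>0\<close> at the origin, while \<open>q 0 = det 1\<close>.\<close>

lemma spec_finite_nonempty:
  fixes A :: "complex^'m^'m"
  shows "finite (spec A)" "spec A \<noteq> {}"
proof -
  define p where "p = det (\<chi> i j. [:- A $ i $ j, if i = j then 1 else 0:] :: complex poly^'m^'m)"
  define q where "q = det (\<chi> i j. [:if i = j then 1 else 0, - A $ i $ j:] :: complex poly^'m^'m)"
  have p: "poly p z = det (mat z - A)" for z
    unfolding p_def poly_det
    by (rule arg_cong[where f=det]) (auto simp: vec_eq_iff mat_def)
  have spec_roots: "spec A = {z. poly p z = 0}" by (auto simp: spec_iff_det p)
  have q: "poly q w = det (mat 1 - mat w ** A)" for w
    unfolding q_def poly_det
    by (rule arg_cong[where f=det])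
      (auto simp: vec_eq_iff mat_mult_entry, auto simp: mat_def)
  have det_mat: "det (mat z :: complex^'m^'m) = z ^ CARD('m)" for z
    by (subst det_diagonal) (auto simp: mat_def)
  have q0: "poly q 0 = 1"
    using det_I[where 'a=complex and 'n='m]
    unfolding q by (simp add: mat_def matrix_matrix_mult_def vec_eq_iff minus_vec_def)
  have rev: "poly q w = w ^ CARD('m) * poly p (1 / w)" if "w \<noteq> 0" for w
  proof -
    have "mat 1 - mat w ** A = mat w ** (mat (1/w) - A)"
      using that by (simp add: vec_eq_iff mat_mult_entry) (simp add: mat_def algebra_simps)
    then show ?thesis unfolding q p by (simp add: det_mul det_mat)
  qed
  have nonconst: "degree p \<noteq> 0"
  proof
    assume "degree p = 0"
    then obtain k where k: "\<And>z. poly p z = k" by (auto elim: degree_eq_zeroE)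
    have "((\<lambda>w. w ^ CARD('m) * k) \<longlongrightarrow> 0) (at 0)"
      by (rule tendsto_eq_intros refl | simp)+
    moreover have "eventually (\<lambda>w. w ^ CARD('m) * k = poly q w) (at 0)"
      by (auto simp: eventually_at_filter rev k)
    ultimately have "(poly q \<longlongrightarrow> 0) (at 0)"
      by (rule Lim_transform_eventually)
    moreover have "(poly q \<longlongrightarrow> poly q 0) (at 0)"
      using poly_isCont isCont_def by blast
    ultimately show False using q0 tendsto_unique[of "at (0::complex)"] by fastforce
  qed
  then have "p \<noteq> 0" by auto
  then show "finite (spec A)"
    using poly_roots_finite[of p] by (simp add: spec_roots)
  have "coeff p (degree p) \<noteq> 0" using \<open>p \<noteq> 0\<close> by simp
  moreover have "degree p \<in> {1..degree p}" using nonconst by simp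
  ultimately obtain z where "(\<Sum>i\<le>degree p. coeff p i * z ^ i) = 0"
    by (metis fundamental_theorem_of_algebra)
  then have "poly p z = 0" by (simp add: poly_altdef)
  then show "spec A \<noteq> {}" by (auto simp: spec_roots)
qed

lemma omega_attained:
  fixes A :: "complex^'m^'m"
  obtains z where "z \<in> spec A" "Re z = omega A"
proof -
  have "omega A \<in> Re ` spec A"
    unfolding omega_def using spec_finite_nonempty[of A] by (intro Min_in) auto
  then show ?thesis using that by auto
qed

text \<open>The library's inner product on \<^typ>\<open>complex^'m\<close> is the real part of the Hermitian one, and for it
the conjugate transpose is still the adjoint. Working with this real inner product
suffices here, since numerical ranges enter only through their real parts.\<close>

lemma inner_conj_transpose:
  fixes A :: "complex^'m^'m"
  shows "inner (A *v x) y = inner x (conj_transpose A *v y)"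
proof -
  have ic: "inner (a * b) c = inner b (cnj a * c)" for a b c :: complex
    by (simp add: inner_complex_def algebra_simps)
  have "inner (A *v x) y = (\<Sum>i\<in>UNIV. \<Sum>j\<in>UNIV. inner (x $ j) (cnj (A $ i $ j) * y $ i))"
    by (simp add: inner_vec_def matrix_vector_mult_def inner_sum_left ic)
  also have "\<dots> = (\<Sum>j\<in>UNIV. \<Sum>i\<in>UNIV. inner (x $ j) (cnj (A $ i $ j) * y $ i))"
    by (rule sum.swap)
  also have "\<dots> = inner x (conj_transpose A *v y)"
    by (simp add: inner_vec_def matrix_vector_mult_def inner_sum_right conj_transpose_def
        map_matrix_def transpose_def)
  finally show ?thesis .
qed

lemma scaleR_matrix_mult_vec: "(c *\<^sub>R A) *v x = c *\<^sub>R (A *v (x :: complex^'m))"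
  by (simp add: vec_eq_iff matrix_vector_mult_def scaleR_sum_right)

lemma inner_herm_part:
  fixes A :: "complex^'m^'m"
  shows "inner (herm_part A *v x) y = (inner (A *v x) y + inner (A *v y) x) / 2"
  by (simp add: herm_part_def scaleR_matrix_mult_vec matrix_vector_mult_add_rdistrib inner_add_left
      inner_conj_transpose[of A y] inner_commute[of "conj_transpose A *v x"])

lemma mult_scaleR_vec: "A *v (c *\<^sub>R x) = c *\<^sub>R (A *v (x :: complex^'m))"
  by (simp add: vec_eq_iff matrix_vector_mult_def scaleR_sum_right)

text \<open>Half of the Rayleigh--Ritz principle, obtained without diagonalising the Hermitian part: the minimum \<open>m\<close> of the
Rayleigh quotient over the unit sphere exists by compactness, and the vanishing of the
first variation at a minimiser \<open>v\<close> says that \<open>v\<close> is an eigenvector for \<open>m\<close>. Hence \<open>m\<close> is one of the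
eigenvalues over which \<^const>\<open>mu\<close> takes the minimum.\<close>

lemma mu_rayleigh:
  fixes A :: "complex^'m^'m"
  shows "mu A * (norm x)\<^sup>2 \<le> inner (A *v x) x"
proof -
  define H where "H = herm_part A"
  \<comment> \<open>The error divided by the comparison term is at most \<open>\<epsilon> * Q * omega A powr (- (1 / r))\<close>,
      so \<open>omega A \<ge> Q powr r\<close> is what is needed.\<close>
  define Q where "Q y = inner (H *v y) y" for y
  have QA: "Q y = inner (A *v y) y" for y
    by (simp add: Q_def H_def inner_herm_part)
  have sym: "inner (H *v y) z = inner (H *v z) y" for y z
    by (simp add: H_def inner_herm_part)
  have "continuous_on (sphere 0 1) Q"
    unfolding Q_def by (intro continuous_intros linear_continuous_on matrix_vector_mul_bounded_linear)
  moreover have "axis undefined 1 \<in> sphere (0 :: complex^'m) 1" by (simp add: norm_axis_1)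
  ultimately obtain v where v: "norm v = 1" and min: "\<And>y. norm y = 1 \<Longrightarrow> Q v \<le> Q y"
    using continuous_attains_inf[of "sphere (0 :: complex^'m) 1" Q] by fastforce
  define m where "m = Q v"
  have ge: "m * (norm y)\<^sup>2 \<le> Q y" for y
  proof (cases "y = 0")
    case False
    then have "m \<le> Q ((1 / norm y) *\<^sub>R y)" unfolding m_def by (intro min) simp
    also have "\<dots> = Q y / (norm y)\<^sup>2" by (simp add: Q_def mult_scaleR_vec power2_eq_square)
    finally show ?thesis using False by (simp add: field_simps)
  qed (simp add: Q_def)
  \<comment> \<open>The form \<open>Q - m\<close> is nonnegative and vanishes at \<open>v\<close>, so its derivative at \<open>v\<close> vanishes;
    it suffices to test this derivative in the direction of the residual \<open>y\<close>, where it is \<open>2 D\<close>.\<close>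
  define y where "y = H *v v - m *\<^sub>R v"
  define K where "K = Q y - m * (norm y)\<^sup>2"
  define D where "D = (norm y)\<^sup>2"
  have quad: "0 \<le> 2 * t * D + t\<^sup>2 * K" for t
  proof -
    have "Q (v + t *\<^sub>R y) = m + 2 * t * inner (H *v v) y + t\<^sup>2 * Q y"
      unfolding Q_def m_def by (simp add: matrix_vector_right_distrib mult_scaleR_vec inner_add_left inner_add_right
          sym[of y v] algebra_simps power2_eq_square)
    moreover have "(norm (v + t *\<^sub>R y))\<^sup>2 = 1 + 2 * t * inner v y + t\<^sup>2 * (norm y)\<^sup>2"
      using v unfolding power2_norm_eq_inner norm_eq_1
      by (simp add: inner_add_left inner_add_right algebra_simps power2_eq_square inner_commute)
    moreover have "inner (H *v v) y = D + m * inner v y"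
      unfolding D_def power2_norm_eq_inner by (subst (2) y_def) (simp add: inner_diff_left)
    ultimately show ?thesis using ge[of "v + t *\<^sub>R y"] by (simp add: K_def algebra_simps)
  qed
  have "K \<ge> 0" using ge[of y] by (simp add: K_def)
  have "D = 0"
  proof (rule ccontr)
    assume "D \<noteq> 0"
    then have "D > 0" by (simp add: D_def)
    define u where "u = D / (K + 1)"
    have u: "u > 0" "D = u * (K + 1)" using \<open>D > 0\<close> \<open>K \<ge> 0\<close> by (auto simp: u_def)
    have "2 * (- u) * D + (- u)\<^sup>2 * K = - (u\<^sup>2 * (K + 2))"
      by (simp add: u(2) power2_eq_square algebra_simps)
    moreover have "u\<^sup>2 * (K + 2) > 0" using u \<open>K \<ge> 0\<close> by simp
    ultimately show False using quad[of "- u"] by linarith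
  qed
  then have "H *v v = complex_of_real m *s v"
    by (simp add: D_def y_def vec_eq_iff scaleR_conv_of_real[where 'a=complex])
  moreover have "v \<noteq> 0" using v by auto
  ultimately have "complex_of_real m \<in> spec H" unfolding spec_def by blast
  moreover have "finite {x. complex_of_real x \<in> spec H}"
    using finite_vimageI[OF spec_finite_nonempty(1)[of H], of complex_of_real]
    by (simp add: vimage_def inj_def)
  ultimately have "mu A \<le> m" unfolding mu_def H_def[symmetric] by (intro Min_le) auto
  then have "mu A * (norm x)\<^sup>2 \<le> m * (norm x)\<^sup>2" by (rule mult_right_mono) simp
  then show ?thesis using ge[of x] by (simp add: QA)
qed

section \<open>The spectral norm\<close>

lemma norm_mult_vec_le: "norm (A *v x) \<le> spectral_norm A * norm (x :: complex^'m)"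
  unfolding spectral_norm_def by (rule onorm) simp

lemma spectral_norm_leI:
  assumes "\<And>x. norm (A *v x) \<le> B * norm (x :: complex^'m)"
  shows "spectral_norm A \<le> B"
  unfolding spectral_norm_def using assms by (rule onorm_le)

lemma spectral_norm_nonneg: "0 \<le> spectral_norm A"
  unfolding spectral_norm_def by (rule onorm_pos_le) simp

lemma norm_entry_le: "norm (A $ i $ j) \<le> spectral_norm (A :: complex^'m^'m)"
proof -
  have "A $ i $ j = (A *v axis j 1) $ i"
    by (simp add: matrix_vector_mult_def axis_def if_distrib cong: if_cong)
  also have "norm \<dots> \<le> norm (A *v axis j 1)" by (rule Finite_Cartesian_Product.norm_nth_le)
  also have "\<dots> \<le> spectral_norm A" using norm_mult_vec_le[of A "axis j 1"] by (simp add: norm_axis_1)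
  finally show ?thesis .
qed

text \<open>Integrability of matrix-valued functions refers to the Frobenius norm, so bounds on the spectral norm
have to be transferred; the loss of a dimension-dependent factor does no harm there.\<close>

lemma norm_le_spectral_norm:
  "norm (A :: complex^'m^'m) \<le> (real CARD('m))\<^sup>2 * spectral_norm A"
proof -
  have "norm A \<le> (\<Sum>i\<in>UNIV. \<Sum>j\<in>UNIV. norm (A $ i $ j))"
    unfolding norm_vec_def[of A]
    by (rule order.trans[OF L2_set_le_sum]) (auto intro!: sum_mono simp: norm_vec_def intro: L2_set_le_sum)
  also have "\<dots> \<le> (\<Sum>i\<in>(UNIV::'m set). \<Sum>j\<in>(UNIV::'m set). spectral_norm A)"
    by (intro sum_mono norm_entry_le)
  finally show ?thesis by (simp add: power2_eq_square)
qed

lemma bounded_linear_mult_vec: "bounded_linear (\<lambda>A :: complex^'m^'m. A *v x)"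
  by (rule linear_conv_bounded_linear[THEN iffD1], rule linearI)
    (simp_all add: matrix_vector_mult_add_rdistrib scaleR_matrix_mult_vec)

lemma cscale_mult_vec: "cscale z A *v x = z *s (A *v x)"
  by (simp add: cscale_def map_matrix_def vec_eq_iff matrix_vector_mult_def sum_distrib_left mult_ac)

lemma bounded_linear_smult_vec: "bounded_linear (\<lambda>w :: complex. w *s v)"
  by (rule linear_conv_bounded_linear[THEN iffD1], rule linearI)
    (simp_all add: vec_eq_iff distrib_right)

lemma norm_cmult_vec: "norm (z *s (x :: complex^'m)) = norm z * norm x"
  by (simp add: norm_vec_def norm_mult L2_set_right_distrib)

section \<open>The matrix exponential\<close>

lemma mat_pow_scaleR: "mat_pow (t *\<^sub>R A) k = t ^ k *\<^sub>R mat_pow A k"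
  by (induction k) (simp_all add: matrix_scalar_ac scalar_matrix_assoc[symmetric])

lemma spectral_norm_mat_pow: "spectral_norm (mat_pow (A :: complex^'m^'m) k) \<le> spectral_norm A ^ k"
proof (rule spectral_norm_leI)
  fix x :: "complex^'m"
  show "norm (mat_pow A k *v x) \<le> spectral_norm A ^ k * norm x"
  proof (induction k)
    case (Suc k)
    have "norm (mat_pow A (Suc k) *v x) \<le> spectral_norm A * norm (mat_pow A k *v x)"
      by (simp add: norm_mult_vec_le flip: matrix_vector_mul_assoc)
    also have "\<dots> \<le> spectral_norm A * (spectral_norm A ^ k * norm x)"
      by (intro mult_left_mono Suc spectral_norm_nonneg)
    finally show ?case by (simp add: mult_ac)
  qed simp
qed

lemma summable_mat_exp:
  fixes A :: "complex^'m^'m"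
  shows "summable (\<lambda>k. (1 / fact k) *\<^sub>R mat_pow A k)"
proof (rule summable_comparison_test')
  show "summable (\<lambda>k. (real CARD('m))\<^sup>2 * (spectral_norm A ^ k /\<^sub>R fact k))"
    by (intro summable_mult summable_exp_generic)
  show "norm ((1 / fact k) *\<^sub>R mat_pow A k) \<le> (real CARD('m))\<^sup>2 * (spectral_norm A ^ k /\<^sub>R fact k)" for k
    using order.trans[OF norm_le_spectral_norm[of "mat_pow A k"]
        mult_left_mono[OF spectral_norm_mat_pow[of A k], of "(real CARD('m))\<^sup>2"]]
    by (simp add: field_simps)
qed

lemma mat_exp_sums: "(\<lambda>k. (1 / fact k) *\<^sub>R mat_pow A k) sums mat_exp A"
  unfolding mat_exp_def using summable_mat_exp by (rule summable_sums)

lemma mat_exp_entry_sums: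
  "(\<lambda>k. (mat_pow A k $ i $ j / fact k) * of_real t ^ k) sums (mat_exp (t *\<^sub>R A) $ i $ j)"
  using bounded_linear.sums[OF bounded_linear_compose[OF bounded_linear_vec_nth bounded_linear_vec_nth]
      mat_exp_sums[of "t *\<^sub>R A"], of i j]
  by (simp add: mat_pow_scaleR scaleR_conv_of_real[where 'a=complex] mult_ac)

lemma mat_exp_zero_mult_vec: "mat_exp (0 *\<^sub>R A) *v x = x"
proof -
  have "mat_exp (0 *\<^sub>R A) $ i $ j = mat 1 $ i $ j" for i j
    using sums_unique2[OF mat_exp_entry_sums[of A i j 0, unfolded of_real_0] powser_sums_zero[of "\<lambda>k. mat_pow A k $ i $ j / fact k"]]
    by simp
  then have "mat_exp (0 *\<^sub>R A) = mat 1" by (simp add: vec_eq_iff)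
  then show ?thesis by (simp add: matrix_vector_mul_lid)
qed

text \<open>Each entry of \<open>exp (t A)\<close> is an entire power series in \<open>t\<close>. Termwise differentiation shifts its
coefficients, and the shifted coefficient is the matching entry of \<open>A ** A ^ k\<close>.\<close>

lemma mat_exp_entry_deriv:
  "((\<lambda>t. mat_exp (t *\<^sub>R A) $ i $ j) has_vector_derivative (A ** mat_exp (t *\<^sub>R A)) $ i $ j) (at t)"
proof -
  define c where "c l k = mat_pow A k $ l $ j / fact k" for l k
  define E where "E z = (\<Sum>k. c i k * z ^ k)" for z
  have smr: "summable (\<lambda>k. c l k * of_real s ^ k)" for l s
    using mat_exp_entry_sums[of A l j s] unfolding c_def by (rule sums_summable)
  have sm: "summable (\<lambda>k. c i k * z ^ k)" for z
    by (rule powser_inside[OF smr[of i "norm z + 1"]]) (simp add: norm_of_real del: of_real_add)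
  have d: "diffs (c i) k = (\<Sum>l\<in>UNIV. A $ i $ l * c l k)" for k
  proof -
    have "diffs (c i) k = mat_pow A (Suc k) $ i $ j / fact k"
      by (simp add: diffs_def c_def del: mat_pow.simps of_nat_Suc) 
    then show ?thesis by (simp add: c_def matrix_matrix_mult_def sum_divide_distrib)
  qed
  have "(\<lambda>k. \<Sum>l\<in>UNIV. A $ i $ l * (c l k * of_real t ^ k))
      sums (\<Sum>l\<in>UNIV. A $ i $ l * mat_exp (t *\<^sub>R A) $ l $ j)"
    unfolding c_def by (intro sums_sum sums_mult mat_exp_entry_sums)
  then have "(\<Sum>k. diffs (c i) k * of_real t ^ k) = (A ** mat_exp (t *\<^sub>R A)) $ i $ j"
    by (simp add: d sum_distrib_right matrix_matrix_mult_def mult.assoc sums_iff)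
  then have "(E has_field_derivative (A ** mat_exp (t *\<^sub>R A)) $ i $ j) (at (of_real t))"
    unfolding E_def using termdiffs_strong_converges_everywhere[OF sm, of "of_real t"] by simp
  then have "((\<lambda>t. E (of_real t)) has_vector_derivative (A ** mat_exp (t *\<^sub>R A)) $ i $ j) (at t)"
    by (rule has_vector_derivative_real_field)
  moreover have "E (of_real s) = mat_exp (s *\<^sub>R A) $ i $ j" for s
    using mat_exp_entry_sums[of A i j s] by (simp add: E_def c_def sums_iff)
  ultimately show ?thesis by simp
qed

lemma has_vector_derivative_vec:
  fixes f :: "real \<Rightarrow> 'a::real_normed_vector^'n"
  assumes "\<And>i. ((\<lambda>t. f t $ i) has_vector_derivative f' $ i) F"
  shows "(f has_vector_derivative f') F"
proof -
  have *: "(\<Sum>i\<in>UNIV. axis i (x $ i)) = x" for x :: "'a^'n"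
    by (simp add: vec_eq_iff axis_def)
  have bl: "bounded_linear (axis i :: 'a \<Rightarrow> 'a^'n)" for i
    by (intro bounded_linear_intro[of _ 1])
      (auto simp: vec_eq_iff axis_def norm_vec_def L2_set_def if_distrib[of norm] if_distrib[of "\<lambda>x. x\<^sup>2"]
        cong: if_cong)
  have "((\<lambda>t. \<Sum>i\<in>UNIV. axis i (f t $ i)) has_vector_derivative (\<Sum>i\<in>UNIV. axis i (f' $ i))) F"
    by (intro has_vector_derivative_sum bounded_linear.has_vector_derivative[OF bl] assms)
  then show ?thesis by (simp add: *)
qed

lemma mat_exp_deriv:
  "((\<lambda>t. mat_exp (t *\<^sub>R A)) has_vector_derivative A ** mat_exp (t *\<^sub>R A)) (at t)"
  by (intro has_vector_derivative_vec mat_exp_entry_deriv)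

lemma continuous_on_mat_exp: "continuous_on S (\<lambda>t. mat_exp ((- t) *\<^sub>R A))"
proof -
  have "continuous_on UNIV (\<lambda>t. mat_exp (t *\<^sub>R A))"
    using mat_exp_deriv has_vector_derivative_continuous
    by (metis continuous_at_imp_continuous_on)
  then show ?thesis
    by (rule continuous_on_compose2) (auto intro: continuous_intros)
qed

text \<open>The energy estimate that links the exponential to the numerical range. With \<open>u s = exp (- s A) x\<close>
the derivative of \<open>(norm (u s))\<^sup>2\<close> is \<open>- 2 * inner (A u) u\<close>, at most \<open>- 2 * mu A * (norm (u s))\<^sup>2\<close> by
\<open>mu_rayleigh\<close>. So \<open>\<phi>\<close>, the energy multiplied by \<open>exp (2 * mu A * s)\<close>, cannot increase.\<close>

lemma norm_mat_exp_le:
  fixes A :: "complex^'m^'m"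
  assumes "t \<ge> 0"
  shows "norm (mat_exp ((- t) *\<^sub>R A) *v x) \<le> exp (- mu A * t) * norm x"
proof -
  define u where "u s = mat_exp (s *\<^sub>R (- A)) *v x" for s
  define \<phi> where "\<phi> s = exp (2 * mu A * s) * inner (u s) (u s)" for s
  have u': "(u has_vector_derivative - (A *v u s)) (at s)" for s
    unfolding u_def
    using bounded_linear.has_vector_derivative[OF bounded_linear_mult_vec mat_exp_deriv[of "- A" s], of x]
    by (simp add: scaleR_matrix_mult_vec[of "-1" A, simplified] flip: matrix_vector_mul_assoc)
  have \<phi>': "(\<phi> has_real_derivative
      2 * exp (2 * mu A * s) * (mu A * (norm (u s))\<^sup>2 - inner (A *v u s) (u s))) (at s)" for s
  proof -
    have "((\<lambda>s. inner (u s) (u s)) has_real_derivative - 2 * inner (A *v u s) (u s)) (at s)"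
      using has_derivative_inner[OF u'[of s, unfolded has_vector_derivative_def] u'[of s, unfolded has_vector_derivative_def]]
      unfolding has_field_derivative_def
      by (rule has_derivative_eq_rhs) (auto simp: fun_eq_iff inner_commute)
    then show ?thesis unfolding \<phi>_def power2_norm_eq_inner
      by (auto intro!: derivative_eq_intros simp: algebra_simps)
  qed
  have "\<phi> t \<le> \<phi> 0"
  proof (rule DERIV_nonpos_imp_nonincreasing[OF assms])
    fix s
    have "2 * exp (2 * mu A * s) * (mu A * (norm (u s))\<^sup>2 - inner (A *v u s) (u s)) \<le> 0"
      using mu_rayleigh[of A "u s"] by (intro mult_nonneg_nonpos) auto
    then show "\<exists>y. (\<phi> has_real_derivative y) (at s) \<and> y \<le> 0" using \<phi>' by blast
  qed
  then have "(exp (mu A * t) * norm (u t))\<^sup>2 \<le> (norm x)\<^sup>2"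
    using mat_exp_zero_mult_vec[of "- A" x]
    by (simp add: \<phi>_def u_def power_mult_distrib power2_norm_eq_inner flip: exp_double)
       (simp add: mult_ac)
  then have "exp (mu A * t) * norm (u t) \<le> norm x"
    by (rule power2_le_imp_le) simp
  then have "norm (u t) \<le> exp (- mu A * t) * norm x"
    by (simp add: exp_minus field_simps)
  then show ?thesis by (simp add: u_def)
qed

lemma mat_exp_eigenvector:
  fixes A :: "complex^'m^'m"
  assumes "A *v v = z *s v"
  shows "mat_exp (t *\<^sub>R A) *v v = exp (of_real t * z) *s v"
proof -
  have pow: "mat_pow A k *v v = z ^ k *s v" for k
    by (induction k)
      (simp_all add: assms vector_scalar_commute vector_smult_assoc mult.commute flip: matrix_vector_mul_assoc)
  have "(\<lambda>k. ((1 / fact k) *\<^sub>R mat_pow (t *\<^sub>R A) k) *v v) sums (mat_exp (t *\<^sub>R A) *v v)"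
    using bounded_linear.sums[OF bounded_linear_mult_vec mat_exp_sums] .
  moreover have "((1 / fact k) *\<^sub>R mat_pow (t *\<^sub>R A) k) *v v = ((of_real t * z) ^ k /\<^sub>R fact k) *s v" for k
    unfolding scaleR_matrix_mult_vec mat_pow_scaleR pow
    by (simp add: vec_eq_iff scaleR_conv_of_real[where 'a=complex] power_mult_distrib field_simps)
  moreover have "(\<lambda>k. ((of_real t * z) ^ k /\<^sub>R fact k) *s v) sums (exp (of_real t * z) *s v)"
    by (rule bounded_linear.sums[OF bounded_linear_smult_vec exp_converges])
  ultimately show ?thesis by (simp add: sums_unique2)
qed

section \<open>Gamma integrals with complex rate\<close>

lemma measurable_lebesgue_on_borel: "f \<in> borel_measurable borel \<Longrightarrow> f \<in> borel_measurable (lebesgue_on S)"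
  by (intro measurable_restrict_space1 measurable_completion) simp

lemma has_integral_Gamma_rate:
  fixes \<beta> \<kappa> :: real
  assumes "\<beta> > 0" "\<kappa> > 0"
  shows "((\<lambda>t. t powr (\<beta> - 1) * exp (- \<kappa> * t)) has_integral Gamma \<beta> / \<kappa> powr \<beta>) {0..}"
proof -
  define f where "f x = x powr (\<beta> - 1) / exp x" for x :: real
  have f: "(f has_integral Gamma \<beta>) {0..}"
    unfolding f_def using Gamma_integral_real[OF assms(1)] .
  then have "f absolutely_integrable_on {0..}"
    by (subst absolutely_integrable_on_iff_nonneg) (auto simp: f_def)
  moreover have img: "(\<lambda>t. \<kappa> * t) ` {0..} = {0..}"
    using assms(2) by (auto simp: image_iff intro!: bexI[of _ "_ / \<kappa>"])
  ultimately have "f absolutely_integrable_on (\<lambda>t. \<kappa> * t) ` {0..} \<and> integral ((\<lambda>t. \<kappa> * t) ` {0..}) f = Gamma \<beta>"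
    using f by (simp add: integral_unique)
  then have "(\<lambda>t. \<bar>\<kappa>\<bar> * f (\<kappa> * t)) absolutely_integrable_on {0..} \<and> integral {0..} (\<lambda>t. \<bar>\<kappa>\<bar> * f (\<kappa> * t)) = Gamma \<beta>"
    using assms(2)
    by (subst has_absolute_integral_change_of_variables_1') (auto intro!: derivative_eq_intros inj_onI)
  then have "((\<lambda>t. \<bar>\<kappa>\<bar> * f (\<kappa> * t)) has_integral Gamma \<beta>) {0..}"
    using set_lebesgue_integral_eq_integral(1) by (auto simp: has_integral_iff)
  then have "((\<lambda>t. (1 / \<kappa> powr \<beta>) * (\<bar>\<kappa>\<bar> * f (\<kappa> * t))) has_integral (1 / \<kappa> powr \<beta>) * Gamma \<beta>) {0..}"
    by (rule has_integral_mult_right)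
  moreover have "(1 / \<kappa> powr \<beta>) * (\<bar>\<kappa>\<bar> * f (\<kappa> * t)) = t powr (\<beta> - 1) * exp (- \<kappa> * t)" if "t \<ge> 0" for t
    using that assms by (simp add: f_def powr_mult powr_diff exp_minus field_simps)
  ultimately show ?thesis by (subst has_integral_cong[of "{0..}"]) auto
qed

text \<open>For real \<open>w\<close> this is a rescaling of the Gamma integral. Both sides are holomorphic in the
right half plane, so the identity theorem extends it. Holomorphy of the integral comes from truncation to the
compact intervals \<open>J k\<close>, which stay away from the singularity at \<open>0\<close>: the truncated integrals are holomorphic
by differentiation under the integral sign and converge locally uniformly, the
tail being dominated by the integral \<open>e k\<close> of a function that is the same for all \<open>w\<close> in a small disc.\<close>

lemma has_integral_Gamma_complex_rate:
  fixes \<beta> :: real and w :: complex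
  assumes "\<beta> > 0" "Re w > 0"
  shows "((\<lambda>t. of_real (t powr (\<beta> - 1)) * exp (- (of_real t * w))) has_integral
           of_real (Gamma \<beta>) * w powr (- of_real \<beta>)) {0..}"
proof -
  define h where "h w t = of_real (t powr (\<beta> - 1)) * exp (- (of_real t * w))" for w :: complex and t :: real
  define H where "H d t = t powr (\<beta> - 1) * exp (- d * t)" for d t :: real
  define G where "G w = integral {0..} (h w)" for w
  define J where "J k = {1 / (real k + 1)..real k + 1}" for k
  define U where "U = {z. Re z > 0}"
  have H: "(H d has_integral Gamma \<beta> / d powr \<beta>) {0..}" if "d > 0" for d
    unfolding H_def using has_integral_Gamma_rate[OF assms(1) that] .
  have norm_h: "norm (h w t) \<le> H d t" if "Re w \<ge> d" "t \<ge> 0" for w d t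
  proof -
    have "norm (h w t) = t powr (\<beta> - 1) * exp (- (t * Re w))" by (simp add: h_def norm_mult)
    also have "\<dots> \<le> H d t"
      unfolding H_def using mult_left_mono[OF that] by (intro mult_left_mono) (simp_all add: mult.commute)
    finally show ?thesis .
  qed
  have int_h: "h w integrable_on {0..}" if "Re w > 0" for w
  proof (rule measurable_bounded_by_integrable_imp_integrable[where g="H (Re w)"])
    show "h w \<in> borel_measurable (lebesgue_on {0..})"
      unfolding h_def by (intro measurable_lebesgue_on_borel) measurable
    show "H (Re w) integrable_on {0..}" using H[OF that] by (rule has_integral_integrable)
  qed (use norm_h in auto)
  have int_hJ: "h w integrable_on J k" for w k
    unfolding J_def h_def by (intro integrable_continuous_real continuous_intros) auto
  have hol_k: "(\<lambda>w. integral (J k) (h w)) holomorphic_on U" for k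
  proof -
    have "(\<lambda>w. integral (cbox (1 / (real k + 1)) (real k + 1)) (h w)) holomorphic_on U"
    proof (rule leibniz_rule_holomorphic)
      show "((\<lambda>w. h w t) has_field_derivative - of_real t * h w t) (at w within U)" for w t
        unfolding h_def by (auto intro!: derivative_eq_intros)
      show "h w integrable_on cbox (1 / (real k + 1)) (real k + 1)" for w
        using int_hJ[of w k] by (simp add: J_def)
      have "x \<noteq> 0" if "1 / (real k + 1) \<le> x" for x
        using that by (auto simp: field_simps)
      then show "continuous_on (U \<times> cbox (1 / (real k + 1)) (real k + 1)) (\<lambda>(w, t). - of_real t * h w t)"
        unfolding h_def case_prod_unfold by (intro continuous_intros) auto
      show "convex U" unfolding U_def by (rule convex_halfspace_Re_gt)
    qed
    then show ?thesis by (simp add: J_def)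
  qed
  have "open U" unfolding U_def by (rule open_halfspace_Re_gt)
  have hol_G: "G holomorphic_on U"
  proof (rule holomorphic_uniform_sequence[OF \<open>open U\<close> hol_k])
    fix z assume "z \<in> U"
    define d where "d = Re z / 2"
    have "d > 0" using \<open>z \<in> U\<close> by (simp add: d_def U_def)
    have Re_ge: "Re w \<ge> d" if "w \<in> cball z d" for w
    proof -
      have "Re (z - w) \<le> d" using complex_Re_le_cmod[of "z - w"] that by (simp add: dist_norm)
      then show ?thesis by (simp add: d_def)
    qed
    define e where "e k = integral {0..} (\<lambda>t. if t \<in> J k then 0 else H d t)" for k
    have restr: "(\<lambda>t. if t \<in> J k then 0 else H d t) integrable_on {0..}" for k
    proof (rule measurable_bounded_by_integrable_imp_integrable[where g="H d"])
      show "(\<lambda>t. if t \<in> J k then 0 else H d t) \<in> borel_measurable (lebesgue_on {0..})"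
        unfolding H_def J_def by (intro measurable_lebesgue_on_borel) measurable
      show "H d integrable_on {0..}" using H[OF \<open>d > 0\<close>] by (rule has_integral_integrable)
    qed (auto simp: H_def)
    have "e \<longlonglongrightarrow> integral {0..} (\<lambda>t::real. 0::real)"
      unfolding e_def
    proof (rule dominated_convergence(2)[OF restr])
      show "H d integrable_on {0..}" using H[OF \<open>d > 0\<close>] by blast
      show "norm (if t \<in> J k then 0 else H d t) \<le> H d t" for k t by (auto simp: H_def)
      show "(\<lambda>k. if t \<in> J k then 0 else H d t) \<longlonglongrightarrow> 0" if "t \<in> {0..}" for t
      proof (cases "t = 0")
        case False
        with that have "t > 0" by simp
        obtain n where n: "real n > max t (1 / t)" using reals_Archimedean2 by blast
        have "eventually (\<lambda>k. t \<in> J k) sequentially"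
        proof (rule eventually_sequentiallyI)
          fix k assume "n \<le> k"
          then have "real k \<ge> t" "real k \<ge> 1 / t" using n by (auto simp: less_imp_le order_trans[of _ "real n"])
          then show "t \<in> J k" using \<open>t > 0\<close> by (auto simp: J_def field_simps)
        qed
        then have "eventually (\<lambda>k. (if t \<in> J k then 0 else H d t) = 0) sequentially"
          by (rule eventually_mono) simp
        then show ?thesis by (rule tendsto_eventually)
      qed (simp add: H_def cong: if_cong)
    qed
    then have e0: "e \<longlonglongrightarrow> 0" by simp
    have bound: "dist (integral (J k) (h w)) (G w) \<le> e k" if "w \<in> cball z d" for w k
    proof -
      have "Re w > 0" using Re_ge[OF that] \<open>d > 0\<close> by linarith
      have J: "J k \<subseteq> {0..}" by (auto simp: J_def intro: order_trans[of 0 "1 / (real k + 1)"])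
      have "((\<lambda>t. if t \<in> J k then h w t else 0) has_integral integral (J k) (h w)) {0..}"
        using int_hJ J by (simp add: has_integral_restrict integrable_integral)
      then have "((\<lambda>t. h w t - (if t \<in> J k then h w t else 0)) has_integral G w - integral (J k) (h w)) {0..}"
        unfolding G_def by (intro has_integral_diff integrable_integral int_h \<open>Re w > 0\<close>)
      moreover have "norm (h w t - (if t \<in> J k then h w t else 0)) \<le> (if t \<in> J k then 0 else H d t)"
        if "t \<in> {0..}" for t
        using norm_h[OF Re_ge[OF \<open>w \<in> _\<close>]] that by auto
      moreover note restr[of k]
      ultimately have "norm (G w - integral (J k) (h w)) \<le> e k"
        using integral_norm_bound_integral[of "\<lambda>t. h w t - (if t \<in> J k then h w t else 0)" "{0..}"
            "\<lambda>t. if t \<in> J k then 0 else H d t"]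
        unfolding e_def by (simp only: integral_unique has_integral_integrable)
      then show ?thesis by (simp add: dist_norm norm_minus_commute)
    qed
    have "uniform_limit (cball z d) (\<lambda>k w. integral (J k) (h w)) G sequentially"
    proof (rule uniform_limitI)
      fix \<epsilon> :: real assume "\<epsilon> > 0"
      with e0 have "eventually (\<lambda>k. e k < \<epsilon>) sequentially" by (simp add: order_tendstoD)
      then show "eventually (\<lambda>k. \<forall>w\<in>cball z d. dist (integral (J k) (h w)) (G w) < \<epsilon>) sequentially"
        by eventually_elim (meson bound le_less_trans)
    qed
    moreover have "cball z d \<subseteq> U" using Re_ge \<open>d > 0\<close> by (force simp: U_def)
    ultimately show "\<exists>d>0. cball z d \<subseteq> U \<and> uniform_limit (cball z d) (\<lambda>k w. integral (J k) (h w)) G sequentially"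
      using \<open>d > 0\<close> by blast
  qed
  have real: "G (of_real x) = of_real (Gamma \<beta>) * of_real x powr (- of_real \<beta>)" if "x > 0" for x
  proof -
    have "((\<lambda>t. of_real (H x t)) has_integral complex_of_real (Gamma \<beta> / x powr \<beta>)) {0..}"
      using has_integral_linear[OF H[OF that] bounded_linear_of_real[where 'a=complex]]
      by (simp only: o_def)
    moreover have "complex_of_real (H x t) = h (of_real x) t" for t
      by (simp add: H_def h_def mult.commute flip: exp_of_real)
    ultimately have "G (of_real x) = of_real (Gamma \<beta> / x powr \<beta>)"
      unfolding G_def by (simp add: integral_unique)
    also have "\<dots> = of_real (Gamma \<beta>) * of_real (x powr (- \<beta>))"
      by (simp add: powr_minus divide_inverse)
    also have "complex_of_real (x powr (- \<beta>)) = of_real x powr (- of_real \<beta>)"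
      using that powr_of_real[of x "- \<beta>"] by simp
    finally show ?thesis .
  qed
  have "G w - of_real (Gamma \<beta>) * w powr (- of_real \<beta>) = 0"
  proof (rule analytic_continuation[where U="complex_of_real ` {0<..}" and S=U and \<xi>=1 and w = w
        and f = "\<lambda>w. G w - of_real (Gamma \<beta>) * w powr (- of_real \<beta>)"])
    show "(\<lambda>w. G w - of_real (Gamma \<beta>) * w powr (- of_real \<beta>)) holomorphic_on U"
      by (intro holomorphic_intros hol_G) (auto simp: U_def complex_nonpos_Reals_iff)
    show "connected U" unfolding U_def by (intro convex_connected convex_halfspace_Re_gt)
    show "1 islimpt complex_of_real ` {0<..}"
      unfolding islimpt_approachable
    proof (intro allI impI)
      fix e :: real assume "e > 0"
      then have "complex_of_real (1 + e / 2) \<in> complex_of_real ` {0<..}" by (intro imageI) simp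
      moreover have "complex_of_real (1 + e / 2) \<noteq> 1" using \<open>e > 0\<close>
        by (metis add_cancel_left_right half_gt_zero less_irrefl of_real_eq_1_iff)
      moreover have "dist (complex_of_real (1 + e / 2)) 1 < e"
        using \<open>e > 0\<close> by (simp add: dist_norm norm_divide)
      ultimately show "\<exists>x'\<in>complex_of_real ` {0<..}. x' \<noteq> 1 \<and> dist x' 1 < e" by blast
    qed
  qed (use assms \<open>open U\<close> in \<open>auto simp: U_def real\<close>)
  then show ?thesis
    using int_h[OF assms(2)] unfolding G_def h_def by (simp add: has_integral_iff)
qed

section \<open>Laplace integrals of the matrix exponential\<close>

lemma bounded_bilinear_cscale: "bounded_bilinear cscale"
proof -
  have "bilinear (cscale :: complex \<Rightarrow> complex^'m^'m \<Rightarrow> _)"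
    unfolding bilinear_def
    by (intro conjI allI linearI) (simp_all add: cscale_def map_matrix_def vec_eq_iff algebra_simps)
  then show ?thesis by (simp add: bilinear_conv_bounded_bilinear)
qed

lemma cscale_of_real: "cscale (of_real c) A = c *\<^sub>R A"
  by (simp add: cscale_def map_matrix_def vec_eq_iff scaleR_conv_of_real[where 'a=complex])

lemma cscale_cscale: "cscale z (cscale w A) = cscale (z * w) A"
  by (simp add: cscale_def map_matrix_def vec_eq_iff)

text \<open>Bounds such as \<open>t powr (\<beta> - 1)\<close> are only available for \<open>t > 0\<close> (\<open>0 powr x\<close> is \<open>0\<close>), but a majorant has to
dominate on all of \<open>{0..}\<close>; it may be given any value at the endpoint.\<close>

lemma has_integral_change_at_0:
  fixes h :: "real \<Rightarrow> 'a::banach"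
  assumes "(h has_integral I) {0..}"
  shows "((\<lambda>t. if t = 0 then c else h t) has_integral I) {0..}"
  by (rule has_integral_spike[of "{0}", OF _ _ assms]) auto

text \<open>The estimate behind both the convergence of all integrals and the size of the error: the factor
\<open>exp (\<nu> * t)\<close> is absorbed by the decay \<open>exp (- mu A * t)\<close> of the matrix exponential, and what is left
is a Gamma integral with rate \<open>mu A - \<nu>\<close>. The bound on the norm is proved by testing on vectors, which
avoids the dimension-dependent constant that the Frobenius norm would bring in.\<close>

lemma laplace_mat_exp:
  fixes A :: "complex^'m^'m" and g :: "real \<Rightarrow> complex"
  assumes "\<beta> > 0" "C \<ge> 0" "\<nu> < mu A"
    and meas: "g \<in> borel_measurable (lebesgue_on {0..})"
    and bound: "\<And>t. t > 0 \<Longrightarrow> norm (g t) \<le> C * t powr (\<beta> - 1) * exp (\<nu> * t)"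
  shows "(\<lambda>t. cscale (g t) (mat_exp ((- t) *\<^sub>R A))) absolutely_integrable_on {0..}"
    and "spectral_norm (integral {0..} (\<lambda>t. cscale (g t) (mat_exp ((- t) *\<^sub>R A))))
           \<le> C * Gamma \<beta> / (mu A - \<nu>) powr \<beta>"
proof -
  define F where "F t = cscale (g t) (mat_exp ((- t) *\<^sub>R A))" for t
  define k where "k t = C * (t powr (\<beta> - 1) * exp (- (mu A - \<nu>) * t))" for t
  define I where "I = C * (Gamma \<beta> / (mu A - \<nu>) powr \<beta>)"
  have k: "(k has_integral I) {0..}"
    unfolding k_def I_def using assms(1,3) by (intro has_integral_mult_right has_integral_Gamma_rate) auto
  have Fx: "norm (F t *v x) \<le> k t * norm x" if "t > 0" for t x
  proof -
    have "norm (F t *v x) \<le> (C * t powr (\<beta> - 1) * exp (\<nu> * t)) * (exp (- mu A * t) * norm x)"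
      unfolding F_def cscale_mult_vec norm_cmult_vec
      using that assms(2) by (intro mult_mono bound norm_mat_exp_le) auto
    also have "\<dots> = k t * norm x" by (simp add: k_def algebra_simps flip: exp_add)
    finally show ?thesis .
  qed
  have "norm (F t) \<le> (real CARD('m))\<^sup>2 * k t" if "t > 0" for t
    by (rule order.trans[OF norm_le_spectral_norm mult_left_mono[OF spectral_norm_leI[OF Fx[OF that]]]]) simp
  moreover have "F \<in> borel_measurable (lebesgue_on {0..})"
    unfolding F_def[abs_def]
  proof (rule borel_measurable_continuous_Pair[OF meas, where H=cscale and g="\<lambda>t. mat_exp ((- t) *\<^sub>R A)"])
    show "(\<lambda>t. mat_exp ((- t) *\<^sub>R A)) \<in> borel_measurable (lebesgue_on {0..})"
      by (intro continuous_imp_measurable_on_sets_lebesgue continuous_on_mat_exp) simp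
    show "continuous_on UNIV (\<lambda>x :: complex \<times> (complex^'m^'m). cscale (fst x) (snd x))"
      by (intro bounded_bilinear.continuous_on[OF bounded_bilinear_cscale] continuous_intros)
  qed
  ultimately have int: "F absolutely_integrable_on {0..}"
    using has_integral_change_at_0[OF has_integral_mult_right[OF k, of "(real CARD('m))\<^sup>2"], of "norm (F 0)"]
    by (intro measurable_bounded_by_integrable_imp_absolutely_integrable
        [where g="\<lambda>t. if t = 0 then norm (F 0) else (real CARD('m))\<^sup>2 * k t"]) auto
  then show "(\<lambda>t. cscale (g t) (mat_exp ((- t) *\<^sub>R A))) absolutely_integrable_on {0..}" by (simp add: F_def[abs_def])
  have "spectral_norm (integral {0..} F) \<le> C * Gamma \<beta> / (mu A - \<nu>) powr \<beta>"
  proof (rule spectral_norm_leI)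
    fix x :: "complex^'m"
    have "(F has_integral integral {0..} F) {0..}"
      using int set_lebesgue_integral_eq_integral(1) by (blast intro: integrable_integral)
    from has_integral_linear[OF this bounded_linear_mult_vec[of x]]
    have Fx_int: "((\<lambda>t. F t *v x) has_integral integral {0..} F *v x) {0..}" by (simp add: o_def)
    have "norm (integral {0..} (\<lambda>t. F t *v x))
        \<le> integral {0..} (\<lambda>t. if t = 0 then norm (F 0 *v x) else k t * norm x)"
      using Fx Fx_int has_integral_change_at_0[OF has_integral_mult_left[OF k], of "norm (F 0 *v x)" "norm x"]
      by (intro integral_norm_bound_integral) auto
    also have "\<dots> = I * norm x"
      by (intro integral_unique has_integral_change_at_0 has_integral_mult_left k)
    finally show "norm (integral {0..} F *v x) \<le> C * Gamma \<beta> / (mu A - \<nu>) powr \<beta> * norm x"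
      using Fx_int by (simp add: integral_unique I_def)
  qed
  then show "spectral_norm (integral {0..} (\<lambda>t. cscale (g t) (mat_exp ((- t) *\<^sub>R A))))
      \<le> C * Gamma \<beta> / (mu A - \<nu>) powr \<beta>" by (simp add: F_def[abs_def])
qed

lemma has_integral_mat_neg_power:
  fixes A :: "complex^'m^'m"
  assumes "\<beta> > 0" "mu A > 0"
  shows "((\<lambda>t. t powr (\<beta> - 1) *\<^sub>R mat_exp ((- t) *\<^sub>R A)) has_integral Gamma \<beta> *\<^sub>R mat_neg_power A \<beta>) {0..}"
proof -
  have "(\<lambda>t. cscale (of_real (t powr (\<beta> - 1))) (mat_exp ((- t) *\<^sub>R A))) absolutely_integrable_on {0..}"
    using assms by (intro laplace_mat_exp(1)[where \<beta>=\<beta> and C=1 and \<nu>=0] measurable_lebesgue_on_borel) auto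
  then have "(\<lambda>t. t powr (\<beta> - 1) *\<^sub>R mat_exp ((- t) *\<^sub>R A)) integrable_on {0..}"
    unfolding cscale_of_real by (rule set_lebesgue_integral_eq_integral(1))
  moreover have "Gamma \<beta> > 0" using assms(1) by (rule Gamma_real_pos)
  ultimately show ?thesis by (simp add: mat_neg_power_def integrable_integral)
qed

text \<open>The integral defining the power acts on an eigenvector by the scalar Gamma integral with rate \<open>z\<close>.\<close>

lemma mat_neg_power_eigenvector:
  fixes A :: "complex^'m^'m"
  assumes "\<beta> > 0" "mu A > 0" "A *v v = z *s v" "Re z > 0"
  shows "mat_neg_power A \<beta> *v v = z powr (- of_real \<beta>) *s v"
proof -
  have exp_v: "mat_exp ((- t) *\<^sub>R A) *v v = exp (- (of_real t * z)) *s v" for t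
    using mat_exp_eigenvector[OF assms(3), of "- t"] by simp
  have "((\<lambda>t. (t powr (\<beta> - 1) *\<^sub>R mat_exp ((- t) *\<^sub>R A)) *v v) has_integral (Gamma \<beta> *\<^sub>R mat_neg_power A \<beta>) *v v) {0..}"
    using has_integral_linear[OF has_integral_mat_neg_power[OF assms(1,2)] bounded_linear_mult_vec] by (simp add: o_def)
  moreover have "(t powr (\<beta> - 1) *\<^sub>R mat_exp ((- t) *\<^sub>R A)) *v v
      = (of_real (t powr (\<beta> - 1)) * exp (- (of_real t * z))) *s v" for t
    unfolding scaleR_matrix_mult_vec exp_v
    by (simp add: vec_eq_iff scaleR_conv_of_real[where 'a=complex])
  moreover have "((\<lambda>t. (of_real (t powr (\<beta> - 1)) * exp (- (of_real t * z))) *s v)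
      has_integral (of_real (Gamma \<beta>) * z powr (- of_real \<beta>)) *s v) {0..}"
    using has_integral_linear[OF has_integral_Gamma_complex_rate[OF assms(1,4)] bounded_linear_smult_vec]
    by (simp add: o_def)
  ultimately have "(Gamma \<beta> *\<^sub>R mat_neg_power A \<beta>) *v v = (of_real (Gamma \<beta>) * z powr (- of_real \<beta>)) *s v"
    by (simp only: has_integral_unique)
  also have "\<dots> = Gamma \<beta> *\<^sub>R (z powr (- of_real \<beta>) *s v)"
    by (simp add: vec_eq_iff scaleR_conv_of_real[where 'a=complex])
  finally have "Gamma \<beta> *\<^sub>R (mat_neg_power A \<beta> *v v) = Gamma \<beta> *\<^sub>R (z powr (- of_real \<beta>) *s v)"
    by (simp only: scaleR_matrix_mult_vec)
  then show ?thesis by (rule real_vector.scale_left_imp_eq[rotated]) (use Gamma_real_pos[OF assms(1)] in auto)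
qed

lemma norm_eigenvalue_le_spectral_norm:
  assumes "A *v v = z *s v" "v \<noteq> (0 :: complex^'m)"
  shows "norm z \<le> spectral_norm A"
proof -
  have "norm z * norm v \<le> spectral_norm A * norm v"
    using norm_mult_vec_le[of A v] unfolding assms(1) norm_cmult_vec .
  then show ?thesis by (rule mult_right_le_imp_le) (use assms(2) in simp)
qed

text \<open>The lower bound for the quantity with which the error is compared.\<close>

lemma spectral_norm_mat_neg_power_ge:
  fixes A :: "complex^'m^'m"
  assumes "\<beta> > 0" "mu A > 0" "z \<in> spec A" "Re z > 0"
  shows "norm z powr (- \<beta>) \<le> spectral_norm (mat_neg_power A \<beta>)"
proof -
  obtain v where v: "v \<noteq> 0" "A *v v = z *s v" using assms(3) unfolding spec_def by blast
  have "norm (z powr (- of_real \<beta>)) \<le> spectral_norm (mat_neg_power A \<beta>)"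
    using mat_neg_power_eigenvector[OF assms(1,2) v(2) assms(4)] v(1) by (rule norm_eigenvalue_le_spectral_norm)
  then show ?thesis by (simp add: norm_powr_real_powr')
qed

lemma spectral_norm_matrix_inv_ge:
  fixes A :: "complex^'m^'m"
  assumes "z \<in> spec A" "0 \<notin> spec A"
  shows "1 / norm z \<le> spectral_norm (matrix_inv A)"
proof -
  obtain v where v: "v \<noteq> 0" "A *v v = z *s v" using assms(1) unfolding spec_def by blast
  have "x = 0" if "A *v x = 0" for x
  proof (rule ccontr)
    assume "x \<noteq> 0"
    moreover have "A *v x = 0 *s x" using that by simp
    ultimately have "0 \<in> spec A" unfolding spec_def by blast
    then show False using assms(2) by contradiction
  qed
  then have "invertible A" unfolding invertible_left_inverse matrix_left_invertible_ker by blast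
  then have "matrix_inv A ** A = mat 1"
    unfolding invertible_def matrix_inv_def by (rule someI2_ex) blast
  then have "v = matrix_inv A *v (A *v v)" by (simp add: matrix_vector_mul_assoc)
  also have "\<dots> = z *s (matrix_inv A *v v)" by (simp add: v(2) vector_scalar_commute)
  finally have vz: "v = z *s (matrix_inv A *v v)" .
  have "z \<noteq> 0" using assms by auto
  have "(1 / z) *s (z *s (matrix_inv A *v v)) = matrix_inv A *v v"
    using \<open>z \<noteq> 0\<close> by (simp add: vector_smult_assoc)
  then have "matrix_inv A *v v = (1 / z) *s v" by (simp only: vz[symmetric])
  from norm_eigenvalue_le_spectral_norm[OF this v(1)] show ?thesis by (simp add: norm_divide)
qed

text \<open>The eigenvalue \<open>z\<close> of least real part controls everything. As it lies in the sector, its modulus is at most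
\<open>1 / sin \<Delta>\<close> times its real part, so \<open>norm z\<close> and \<open>omega A\<close> are of the same order. That \<open>sin \<Delta>\<close> is positive
follows from the existence of \<open>z\<close>, since the sector is empty for \<open>\<Delta> > pi / 2\<close>.\<close>

lemma admissible_eigenvalue:
  fixes A :: "complex^'m^'m"
  assumes "A \<in> admissible \<Delta> \<eta>" "\<Delta> > 0" "\<eta> > 0"
  obtains z where "z \<in> spec A" "Re z = omega A" "omega A > 0" "sin \<Delta> > 0"
    "norm z * sin \<Delta> \<le> omega A" "\<eta> * omega A \<le> mu A" "0 \<notin> spec A"
proof -
  have sp: "spec A \<subseteq> {z. z \<noteq> 0 \<and> \<bar>Arg z\<bar> \<le> pi / 2 - \<Delta>}" and mu: "\<eta> * omega A \<le> mu A"
    using assms(1) by (auto simp: admissible_def)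
  obtain z where z: "z \<in> spec A" "Re z = omega A" by (rule omega_attained)
  have "z \<noteq> 0" and Arg: "\<bar>Arg z\<bar> \<le> pi / 2 - \<Delta>" using sp z(1) by auto
  then have "\<Delta> < pi" using pi_gt_zero by linarith
  then have "sin \<Delta> > 0" using assms(2) by (simp add: sin_gt_zero)
  have "sin \<Delta> = cos (pi / 2 - \<Delta>)" by (simp add: cos_diff)
  also have "\<dots> \<le> cos \<bar>Arg z\<bar>" using Arg assms(2) by (intro cos_monotone_0_pi_le) auto
  finally have "norm z * sin \<Delta> \<le> norm z * cos (Arg z)" by (intro mult_left_mono) auto
  also have "\<dots> = Re z"
    using arg_cong[OF Arg_eq[OF \<open>z \<noteq> 0\<close>], of Re] by (simp add: Re_exp)
  finally have "norm z * sin \<Delta> \<le> omega A" by (simp add: z(2))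
  moreover from this have "omega A > 0" using \<open>sin \<Delta> > 0\<close> \<open>z \<noteq> 0\<close>
    by (meson less_le_trans mult_pos_pos zero_less_norm_iff)
  ultimately show ?thesis using that z mu sp \<open>sin \<Delta> > 0\<close> by blast
qed

section \<open>The remainder of the expansion\<close>

text \<open>Away from \<open>0\<close> any power is dominated by any other one at the cost of a factor \<open>exp t\<close>. The constant
\<open>K\<close> covers \<open>q = s - p \<le> 0\<close>, where \<open>t powr q\<close> is largest at \<open>t = c\<close>, as well as \<open>q > 0\<close>, where
\<open>ln (t / q) \<le> t / q\<close> is used.\<close>

lemma powr_le_powr_mult_exp:
  fixes c p s :: real
  assumes "c > 0"
  obtains K where "K \<ge> 0" "\<And>t. t \<ge> c \<Longrightarrow> t powr s \<le> K * t powr p * exp t"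
proof -
  define q where "q = s - p"
  define K where "K = c powr q + exp (q * ln \<bar>q\<bar>)"
  have "t powr q \<le> K * exp t" if "t \<ge> c" for t
  proof (cases "q \<le> 0")
    case True
    have "t powr q \<le> c powr q" using True assms that by (intro powr_mono2') auto
    also have "\<dots> \<le> K * 1" by (simp add: K_def)
    also have "\<dots> \<le> K * exp t" using assms that by (intro mult_left_mono) (auto simp: K_def)
    finally show ?thesis .
  next
    case False
    then have "q > 0" by simp
    have "t > 0" using assms that by simp
    have "ln (t / q) \<le> t / q" using \<open>t > 0\<close> \<open>q > 0\<close> ln_le_minus_one[of "t / q"] by simp
    then have "q * (ln t - ln q) \<le> t" using \<open>t > 0\<close> \<open>q > 0\<close> by (simp add: ln_div field_simps)
    then have "q * ln t \<le> q * ln \<bar>q\<bar> + t" using \<open>q > 0\<close> by (simp add: algebra_simps)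
    then have "t powr q \<le> exp (q * ln \<bar>q\<bar>) * exp t" using \<open>t > 0\<close> by (simp add: powr_def flip: exp_add)
    also have "\<dots> \<le> K * exp t" by (intro mult_right_mono) (auto simp: K_def)
    finally show ?thesis .
  qed
  then have "t powr s \<le> K * t powr p * exp t" if "t \<ge> c" for t
  proof -
    have "t powr s = t powr p * t powr q" by (simp add: q_def flip: powr_add)
    also have "\<dots> \<le> t powr p * (K * exp t)"
      using \<open>\<And>t. t \<ge> c \<Longrightarrow> t powr q \<le> K * exp t\<close>[OF that] by (intro mult_left_mono) auto
    finally show ?thesis by (simp add: mult_ac)
  qed
  moreover have "K \<ge> 0" by (simp add: K_def)
  ultimately show ?thesis using that by blast
qed

text \<open>In the variable \<open>t powr (1 / r)\<close> this is the usual bound for the tail of a power series strictly inside its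
disc of convergence. The terms at \<open>T\<close> are bounded by some \<open>B\<close>, and for \<open>t \<le> c\<close>
the terms of the tail are dominated by a geometric series with ratio \<open>q = (c / T) powr (1 / r) < 1\<close>.\<close>

lemma series_remainder_bound:
  fixes a :: "nat \<Rightarrow> complex" and r c T :: real
  assumes "r > 0" "0 < c" "c < T"
    and series: "\<And>t. 0 < t \<Longrightarrow> t \<le> T \<Longrightarrow>
      (\<lambda>n. a (Suc n) * of_real (t powr (real (Suc n) / r - 1))) sums f t"
  obtains C where "C \<ge> 0" "\<And>t. 0 < t \<Longrightarrow> t \<le> c \<Longrightarrow>
      norm (f t - (\<Sum>n<N. a (Suc n) * of_real (t powr (real (Suc n) / r - 1))))
        \<le> C * t powr (real (Suc N) / r - 1)"
proof -
  define u where "u t n = a (Suc n) * of_real (t powr (real (Suc n) / r - 1))" for t n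
  have u_sums: "u t sums f t" if "0 < t" "t \<le> T" for t
    unfolding u_def using series[OF that] .
  define p where "p = real (Suc N) / r - 1"
  define q where "q = (c / T) powr (1 / r)"
  have q: "0 \<le> q" "q < 1"
    using powr_less_mono2[of "1 / r" "c / T" 1] assms(1-3) by (auto simp: q_def)
  have "T > 0" using assms by simp
  then have "Bseq (u T)"
    using u_sums[of T] by (intro convergent_imp_Bseq) (auto simp: convergent_def sums_iff intro: summable_LIMSEQ_zero)
  then obtain B where B: "B > 0" "\<And>n. norm (u T n) \<le> B" by (auto elim: BseqE)
  have "norm (f t - (\<Sum>n<N. u t n)) \<le> B / (1 - q) * T powr (- p) * t powr p" if t: "0 < t" "t \<le> c" for t
  proof -
    define x where "x = t / T"
    have x: "0 < x" "t = x * T" using t \<open>T > 0\<close> by (auto simp: x_def)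
    have "x powr (1 / r) \<le> q"
      unfolding q_def x_def using assms t by (intro powr_mono2 divide_right_mono) auto
    have term_le: "norm (u t (k + N)) \<le> B * x powr p * q ^ k" for k
    proof -
      have "u t n = u T n * of_real (x powr (real (Suc n) / r - 1))" for n
        using x \<open>T > 0\<close> by (simp add: u_def powr_mult mult_ac)
      then have "norm (u t (k + N)) = norm (u T (k + N)) * x powr (real (Suc (k + N)) / r - 1)"
        by (simp only: norm_mult norm_of_real abs_of_nonneg powr_ge_zero)
      also have "real (Suc (k + N)) / r - 1 = p + real k * (1 / r)"
        by (simp add: p_def add_divide_distrib)
      also have "x powr (p + real k * (1 / r)) = x powr p * (x powr (1 / r)) ^ k"
        using x by (simp add: powr_add powr_powr mult.commute flip: powr_realpow)
      also have "norm (u T (k + N)) * \<dots> \<le> B * (x powr p * q ^ k)"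
        using B \<open>x powr (1 / r) \<le> q\<close> by (intro mult_mono power_mono) auto
      finally show ?thesis by (simp add: mult_ac)
    qed
    have sg: "(\<lambda>k. B * x powr p * q ^ k) sums (B * x powr p * (1 / (1 - q)))"
      using q by (intro sums_mult geometric_sums) auto
    have "(\<lambda>k. u t (k + N)) sums (f t - (\<Sum>n<N. u t n))"
      using u_sums[of t] t assms by (intro sums_split_initial_segment) auto
    then have "norm (f t - (\<Sum>n<N. u t n)) \<le> B * x powr p * (1 / (1 - q))"
      using norm_suminf_le[OF term_le sums_summable[OF sg]] sg by (simp add: sums_iff)
    also have "x powr p = T powr (- p) * t powr p"
      using t \<open>T > 0\<close> by (simp add: x_def powr_divide powr_minus field_simps)
    finally show ?thesis by simp
  qed
  moreover have "B / (1 - q) * T powr (- p) \<ge> 0" using B q by simp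
  ultimately show ?thesis using that unfolding u_def p_def by blast
qed

text \<open>One bound for all \<open>t > 0\<close>: near \<open>0\<close> it is the tail estimate of the series. For \<open>t \<ge> c\<close> the function and each
subtracted term are handled separately, and every power of \<open>t\<close> is converted into the required one by
\<open>powr_le_powr_mult_exp\<close>; this is why \<open>b\<close> becomes \<open>b + 1\<close>.\<close>

lemma remainder_bound:
  fixes a :: "nat \<Rightarrow> complex" and f :: "real \<Rightarrow> complex" and r c \<delta> M0 b :: real
  assumes "r > 0" "c > 0" "\<delta> > 0" "M0 > 0" "b > 0"
    and series: "\<And>t. 0 < t \<Longrightarrow> t \<le> c + \<delta> \<Longrightarrow>
           (\<lambda>n. a (Suc n) * of_real (t powr (real (Suc n) / r - 1))) sums f t"
    and growth: "\<And>t. t \<ge> c \<Longrightarrow> norm (f t) < M0 * exp (b * t)"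
  obtains C where "C \<ge> 0" "\<And>t. t > 0 \<Longrightarrow>
      norm (f t - (\<Sum>n=1..N. a n * of_real (t powr (real n / r - 1))))
        \<le> C * t powr (real (Suc N) / r - 1) * exp ((b + 1) * t)"
proof -
  define p where "p = real (Suc N) / r - 1"
  define S where "S t = (\<Sum>n=1..N. a n * of_real (t powr (real n / r - 1)))" for t
  have S: "S t = (\<Sum>n<N. a (Suc n) * of_real (t powr (real (Suc n) / r - 1)))" for t
    unfolding S_def One_nat_def by (rule sum.atLeast1_atMost_eq)
  have "c < c + \<delta>" using assms(3) by simp
  obtain C1 where "C1 \<ge> 0" and near: "\<And>t. 0 < t \<Longrightarrow> t \<le> c \<Longrightarrow>
      norm (f t - (\<Sum>n<N. a (Suc n) * of_real (t powr (real (Suc n) / r - 1))))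
        \<le> C1 * t powr (real (Suc N) / r - 1)"
    by (rule series_remainder_bound[OF assms(1,2) \<open>c < c + \<delta>\<close> series, of N]; (assumption | rule that; blast))
  have C1: "C1 \<ge> 0" "\<And>t. 0 < t \<Longrightarrow> t \<le> c \<Longrightarrow> norm (f t - S t) \<le> C1 * t powr p"
    unfolding S p_def by (fact \<open>C1 \<ge> 0\<close>, rule near)
  have "\<exists>K. K \<ge> 0 \<and> (\<forall>t\<ge>c. t powr s \<le> K * t powr p * exp t)" for s
    using powr_le_powr_mult_exp[OF assms(2), of s p] by metis
  then obtain K where K: "\<And>s. K s \<ge> 0" "\<And>s t. t \<ge> c \<Longrightarrow> t powr s \<le> K s * t powr p * exp t"
    by metis
  define C2 where "C2 = M0 * K 0 + (\<Sum>n=1..N. norm (a n) * K (real n / r - 1))"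
  have far: "norm (f t - S t) \<le> C2 * t powr p * exp ((b + 1) * t)" if "t \<ge> c" for t
  proof -
    have "t > 0" using that assms by simp
    have exp_le: "exp t \<le> exp ((b + 1) * t)" using \<open>t > 0\<close> assms(5) by simp
    have "1 \<le> K 0 * t powr p * exp t" using K(2)[OF that, of 0] \<open>t > 0\<close> by simp
    then have "M0 * exp (b * t) * 1 \<le> M0 * exp (b * t) * (K 0 * t powr p * exp t)"
      using assms(4) by (intro mult_left_mono) auto
    also have "\<dots> = M0 * K 0 * (t powr p * exp ((b + 1) * t))"
      by (simp add: exp_add algebra_simps)
    finally have 1: "norm (f t) \<le> M0 * K 0 * (t powr p * exp ((b + 1) * t))"
      using growth[OF that] by simp
    have "norm (S t) \<le> (\<Sum>n=1..N. norm (a n) * t powr (real n / r - 1))"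
      unfolding S_def by (rule sum_norm_le) (simp add: norm_mult)
    also have "\<dots> \<le> (\<Sum>n=1..N. norm (a n) * (K (real n / r - 1) * t powr p * exp ((b + 1) * t)))"
      using K exp_le that by (intro sum_mono mult_left_mono order.trans[OF K(2)]) auto
    also have "\<dots> = (\<Sum>n=1..N. norm (a n) * K (real n / r - 1)) * (t powr p * exp ((b + 1) * t))"
      unfolding sum_distrib_right by (intro sum.cong refl) (simp add: mult_ac)
    finally have "norm (S t) \<le> \<dots>" .
    with 1 have "norm (f t - S t) \<le> C2 * (t powr p * exp ((b + 1) * t))"
      using norm_triangle_ineq4[of "f t" "S t"] unfolding C2_def distrib_right by linarith
    then show ?thesis by (simp add: mult_ac)
  qed
  have "norm (f t - S t) \<le> (C1 + C2) * t powr p * exp ((b + 1) * t)" if "t > 0" for t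
  proof (cases "t \<le> c")
    case True
    have "C2 \<ge> 0" unfolding C2_def using K assms by (intro add_nonneg_nonneg sum_nonneg mult_nonneg_nonneg) auto
    then have "C1 * t powr p * 1 \<le> (C1 + C2) * t powr p * exp ((b + 1) * t)"
      using C1(1) that assms by (intro mult_mono) auto
    then show ?thesis using C1(2)[OF that True] by simp
  next
    case False
    then have "norm (f t - S t) \<le> C2 * t powr p * exp ((b + 1) * t)" using far by simp
    also have "\<dots> \<le> (C1 + C2) * t powr p * exp ((b + 1) * t)"
      using C1(1) by (intro mult_right_mono) auto
    finally show ?thesis .
  qed
  moreover have "C1 + C2 \<ge> 0" unfolding C2_def using C1 K assms
    by (intro add_nonneg_nonneg sum_nonneg mult_nonneg_nonneg) auto
  ultimately show ?thesis using that unfolding S_def p_def by blast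
qed

text \<open>Together with the pointwise bound of \<open>remainder_bound\<close> this gives integrability over the half line by
domination. The extension of \<open>f\<close> by \<open>0\<close> is the pointwise limit of its restrictions to bounded intervals.\<close>

lemma measurable_half_line:
  fixes f :: "real \<Rightarrow> complex"
  assumes "\<And>T. T > 0 \<Longrightarrow> f absolutely_integrable_on {0..T}"
  shows "f \<in> borel_measurable (lebesgue_on {0..})"
proof -
  have "(\<lambda>t. if t \<in> {0..} then f t else 0) \<in> borel_measurable lebesgue"
  proof (rule borel_measurable_LIMSEQ_metric)
    show "(\<lambda>t. if t \<in> {0..real k + 1} then f t else 0) \<in> borel_measurable lebesgue" for k
    proof -
      have "f integrable_on {0..real k + 1}"
        using assms[of "real k + 1"] by (intro set_lebesgue_integral_eq_integral(1)) simp
      then have "f \<in> borel_measurable (lebesgue_on {0..real k + 1})" by (rule integrable_imp_measurable)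
      then show ?thesis by (rule borel_measurable_if_I) simp
    qed
    show "(\<lambda>k. if t \<in> {0..real k + 1} then f t else 0) \<longlonglongrightarrow> (if t \<in> {0..} then f t else 0)" for t
    proof (rule tendsto_eventually)
      obtain n where n: "real n > t" using reals_Archimedean2 by blast
      show "eventually (\<lambda>k. (if t \<in> {0..real k + 1} then f t else 0) = (if t \<in> {0..} then f t else 0)) sequentially"
        using n by (intro eventually_sequentiallyI[of n]) (auto simp: not_le less_imp_le)
    qed
  qed
  then show ?thesis by (rule borel_measurable_if_D)
qed

section \<open>The asymptotic expansion\<close>

text \<open>The \<open>n\<close>-th term of the expansion is the integral of \<open>a n * t powr (n / r - 1)\<close> against the matrix
exponential, so the error is the same integral for the remainder of \<open>f\<close>.\<close>

lemma expansion_error_le: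
  fixes f :: "real \<Rightarrow> complex" and A :: "complex^'m^'m"
  assumes "r > 0" "mu A > \<nu>" "\<nu> \<ge> 0" "C \<ge> 0"
    and meas: "f \<in> borel_measurable (lebesgue_on {0..})"
    and int: "(\<lambda>t. cscale (f t) (mat_exp ((- t) *\<^sub>R A))) absolutely_integrable_on {0..}"
    and bound: "\<And>t. t > 0 \<Longrightarrow> norm (f t - (\<Sum>n=1..N. a n * of_real (t powr (real n / r - 1))))
        \<le> C * t powr (real (Suc N) / r - 1) * exp (\<nu> * t)"
  shows "spectral_norm (integral {0..} (\<lambda>t. cscale (f t) (mat_exp ((- t) *\<^sub>R A)))
           - (\<Sum>n=1..N. cscale (a n * of_real (Gamma (real n / r))) (mat_neg_power A (real n / r))))
         \<le> C * Gamma (real (Suc N) / r) / (mu A - \<nu>) powr (real (Suc N) / r)"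
proof -
  define E where "E t = mat_exp ((- t) *\<^sub>R A)" for t
  define R where "R t = f t - (\<Sum>n=1..N. a n * of_real (t powr (real n / r - 1)))" for t
  have "((\<lambda>t. cscale (a n * of_real (t powr (real n / r - 1))) (E t))
      has_integral cscale (a n * of_real (Gamma (real n / r))) (mat_neg_power A (real n / r))) {0..}"
    if "n \<in> {1..N}" for n
  proof -
    have "((\<lambda>t. t powr (real n / r - 1) *\<^sub>R E t) has_integral Gamma (real n / r) *\<^sub>R mat_neg_power A (real n / r)) {0..}"
      unfolding E_def using that assms by (intro has_integral_mat_neg_power) auto
    from has_integral_linear[OF this bounded_bilinear.bounded_linear_right[OF bounded_bilinear_cscale, of "a n"]] show ?thesis
      by (simp only: o_def cscale_of_real[symmetric] cscale_cscale)
  qed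
  moreover have "((\<lambda>t. cscale (f t) (E t)) has_integral integral {0..} (\<lambda>t. cscale (f t) (E t))) {0..}"
    using int unfolding E_def by (intro integrable_integral set_lebesgue_integral_eq_integral(1))
  ultimately have "((\<lambda>t. cscale (f t) (E t) - (\<Sum>n=1..N. cscale (a n * of_real (t powr (real n / r - 1))) (E t)))
      has_integral integral {0..} (\<lambda>t. cscale (f t) (E t))
        - (\<Sum>n=1..N. cscale (a n * of_real (Gamma (real n / r))) (mat_neg_power A (real n / r)))) {0..}"
    by (intro has_integral_diff has_integral_sum) auto
  then have "((\<lambda>t. cscale (R t) (E t)) has_integral integral {0..} (\<lambda>t. cscale (f t) (E t))
        - (\<Sum>n=1..N. cscale (a n * of_real (Gamma (real n / r))) (mat_neg_power A (real n / r)))) {0..}"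
    by (simp only: R_def bounded_bilinear.diff_left[OF bounded_bilinear_cscale]
        bounded_bilinear.sum_left[OF bounded_bilinear_cscale])
  moreover have "spectral_norm (integral {0..} (\<lambda>t. cscale (R t) (E t)))
      \<le> C * Gamma (real (Suc N) / r) / (mu A - \<nu>) powr (real (Suc N) / r)"
    unfolding E_def
  proof (rule laplace_mat_exp(2))
    show "R \<in> borel_measurable (lebesgue_on {0..})"
      unfolding R_def
      by (intro borel_measurable_diff meas measurable_lebesgue_on_borel) measurable
    show "norm (R t) \<le> C * t powr (real (Suc N) / r - 1) * exp (\<nu> * t)" if "t > 0" for t
      unfolding R_def using bound[OF that] .
  qed (use assms in auto)
  ultimately show ?thesis unfolding E_def by (simp only: integral_unique)
qed

text \<open>The norm of the inverse is at least \<open>1 / norm z\<close> for every eigenvalue \<open>z\<close>; applied to the eigenvalue of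
least real part, this turns smallness of the inverse into largeness of \<open>omega A\<close>, uniformly over
the admissible matrices.\<close>

lemma omega_gt_of_small_inverse:
  fixes A :: "complex^'m^'m"
  assumes "A \<in> admissible \<Delta> \<eta>" "\<Delta> > 0" "\<eta> > 0" "W > 0"
    and small: "spectral_norm (matrix_inv A) < sin \<Delta> / W"
  shows "omega A > W"
proof -
  obtain z where z: "z \<in> spec A" "omega A > 0" "sin \<Delta> > 0" "norm z * sin \<Delta> \<le> omega A" "0 \<notin> spec A"
    using assms(1-3) by (rule admissible_eigenvalue)
  have "norm z > 0" using z by auto
  have "1 / norm z < sin \<Delta> / W"
    using spectral_norm_matrix_inv_ge[OF z(1,5)] small by linarith
  then have "W < norm z * sin \<Delta>" using \<open>norm z > 0\<close> assms(4) by (simp add: field_simps)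
  then show ?thesis using z(4) by linarith
qed

theorem theorem3p1:
  fixes \<Delta> \<eta> r c \<delta> M0 b :: real
    and f :: "real \<Rightarrow> complex"
    and a :: "nat \<Rightarrow> complex"
  assumes "\<Delta> > 0" and "\<eta> > 0"
    and "r > 0" and "c > 0" and "\<delta> > 0"
    and "\<And>T. T > 0 \<Longrightarrow> f absolutely_integrable_on {0..T}"
    and "\<And>t. 0 < t \<Longrightarrow> t \<le> c + \<delta> \<Longrightarrow>
           (\<lambda>n. a (Suc n) * of_real (t powr (real (Suc n) / r - 1))) sums f t"
    and "M0 > 0" and "b > 0"
    and "\<And>t. t \<ge> c \<Longrightarrow> norm (f t) < M0 * exp (b * t)"
  shows "(\<exists>\<rho>>0. \<forall>A \<in> (admissible \<Delta> \<eta> :: (complex^'m^'m) set).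
            spectral_norm (matrix_inv A) < \<rho> \<longrightarrow>
            (\<lambda>t. cscale (f t) (mat_exp ((-t) *\<^sub>R A))) absolutely_integrable_on {0..})
       \<and> has_inverse_power_expansion
            (\<lambda>A :: complex^'m^'m. integral {0..} (\<lambda>t. cscale (f t) (mat_exp ((-t) *\<^sub>R A))))
            (\<lambda>n. a n * of_real (Gamma (real n / r)))
            r
            (admissible \<Delta> \<eta>)"
proof (cases "admissible \<Delta> \<eta> = ({} :: (complex^'m^'m) set)")
  case True
  then show ?thesis by (auto simp: has_inverse_power_expansion_def intro: exI[of _ 1])
next
  case False
  then have "sin \<Delta> > 0" using admissible_eigenvalue assms(1,2) by blast
  define F where "F A t = cscale (f t) (mat_exp ((- t) *\<^sub>R A))" for A :: "complex^'m^'m" and t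
  have meas: "f \<in> borel_measurable (lebesgue_on {0..})"
    using assms(6) by (rule measurable_half_line)
  \<comment> \<open>For \<open>omega A > W0\<close> the shift by \<open>b + 1\<close> costs at most half of \<open>\<eta> * omega A\<close>.\<close>
  define W0 where "W0 = 2 * (b + 1) / \<eta>"
  have "W0 > 0" using assms by (simp add: W0_def)
  have mu: "mu A - (b + 1) \<ge> \<eta> * omega A / 2" "mu A > b + 1"
    if "A \<in> admissible \<Delta> \<eta>" "omega A > W0" for A :: "complex^'m^'m"
  proof -
    have "\<eta> * omega A \<le> mu A" using that(1) by (simp add: admissible_def)
    moreover have "\<eta> * omega A > 2 * (b + 1)"
      using that(2) assms(2) by (simp add: W0_def field_simps)
    ultimately show "mu A - (b + 1) \<ge> \<eta> * omega A / 2" "mu A > b + 1" using assms(9) by simp_all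
  qed
  \<comment> \<open>The case of no subtracted terms is a bound for \<open>f\<close> itself.\<close>
  obtain C0 where C0: "C0 \<ge> 0" "\<And>t. t > 0 \<Longrightarrow> norm (f t - (\<Sum>n=1..0. a n * of_real (t powr (real n / r - 1))))
        \<le> C0 * t powr (real (Suc 0) / r - 1) * exp ((b + 1) * t)"
    using remainder_bound[OF assms(3,4,5,8,9,7,10), of 0] by blast
  have int: "F A absolutely_integrable_on {0..}" if "A \<in> admissible \<Delta> \<eta>" "omega A > W0" for A :: "complex^'m^'m"
    unfolding F_def using C0 assms(3) mu(2)[OF that]
    by (intro laplace_mat_exp(1)[where C=C0 and \<beta>="1 / r" and \<nu>="b + 1"] meas) auto
  have "\<exists>\<rho>>0. \<forall>A \<in> (admissible \<Delta> \<eta> :: (complex^'m^'m) set).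
      spectral_norm (matrix_inv A) < \<rho> \<longrightarrow> F A absolutely_integrable_on {0..}"
    using omega_gt_of_small_inverse[OF _ assms(1,2) \<open>W0 > 0\<close>] int \<open>W0 > 0\<close> \<open>sin \<Delta> > 0\<close>
    by (intro exI[of _ "sin \<Delta> / W0"]) auto
  moreover have "has_inverse_power_expansion (\<lambda>A :: complex^'m^'m. integral {0..} (F A))
      (\<lambda>n. a n * of_real (Gamma (real n / r))) r (admissible \<Delta> \<eta>)"
    unfolding has_inverse_power_expansion_def
  proof (intro allI impI)
    fix N :: nat and \<epsilon> :: real
    assume "N \<ge> 1" "\<epsilon> > 0"
    define \<beta> where "\<beta> = real N / r"
    define \<gamma> where "\<gamma> = real (Suc N) / r"
    have "\<beta> > 0" "\<gamma> > 0" using \<open>N \<ge> 1\<close> assms(3) by (auto simp: \<beta>_def \<gamma>_def)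
    have \<gamma>: "\<gamma> = \<beta> + 1 / r" by (simp add: \<beta>_def \<gamma>_def add_divide_distrib)
    obtain C where C: "C \<ge> 0" "\<And>t. t > 0 \<Longrightarrow> norm (f t - (\<Sum>n=1..N. a n * of_real (t powr (real n / r - 1))))
        \<le> C * t powr (real (Suc N) / r - 1) * exp ((b + 1) * t)"
      using remainder_bound[OF assms(3,4,5,8,9,7,10), of N] by blast
    define Q where "Q = C * Gamma \<gamma> * (\<eta> / 2) powr (- \<gamma>) * sin \<Delta> powr (- \<beta>) / \<epsilon>"
    have "Q \<ge> 0" unfolding Q_def
      using C Gamma_real_pos[OF \<open>\<gamma> > 0\<close>] \<open>\<epsilon> > 0\<close> by simp
    define W where "W = W0 + Q powr r"
    have "W > 0" using \<open>W0 > 0\<close> by (simp add: W_def add_pos_nonneg)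
    have main: "spectral_norm (integral {0..} (F A)
           - (\<Sum>n=1..N. cscale (a n * of_real (Gamma (real n / r))) (mat_neg_power A (real n / r))))
          \<le> \<epsilon> * spectral_norm (mat_neg_power A (real N / r))"
      if A: "A \<in> admissible \<Delta> \<eta>" and small: "spectral_norm (matrix_inv A) < sin \<Delta> / W" for A :: "complex^'m^'m"
    proof -
      have W: "omega A > W" by (rule omega_gt_of_small_inverse[OF A assms(1,2) \<open>W > 0\<close> small])
      then have "omega A > W0" "omega A > Q powr r" using \<open>W0 > 0\<close> by (auto simp: W_def intro: le_less_trans[rotated])
      obtain z where z: "z \<in> spec A" "Re z = omega A" "omega A > 0" "norm z * sin \<Delta> \<le> omega A" "0 \<notin> spec A"
        using A assms(1,2) by (rule admissible_eigenvalue)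
      have "norm z > 0" using z by auto
      define w where "w = omega A"
      have "w > 0" using z by (simp add: w_def)
      have "Q = (Q powr r) powr (1 / r)" using \<open>Q \<ge> 0\<close> assms(3) by (simp add: powr_powr)
      also have "\<dots> \<le> w powr (1 / r)"
        unfolding w_def using \<open>omega A > Q powr r\<close> assms(3) by (intro powr_mono2) auto
      finally have Qw: "Q \<le> w powr (1 / r)" .
      have "spectral_norm (integral {0..} (F A)
           - (\<Sum>n=1..N. cscale (a n * of_real (Gamma (real n / r))) (mat_neg_power A (real n / r))))
          \<le> C * Gamma \<gamma> / (mu A - (b + 1)) powr \<gamma>"
        unfolding F_def \<gamma>_def
        by (rule expansion_error_le[OF assms(3) mu(2)[OF A \<open>omega A > W0\<close>] _ C(1) meas
              int[OF A \<open>omega A > W0\<close>, unfolded F_def[abs_def]] C(2)])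
          (use assms(9) in auto)
      also have "\<dots> \<le> C * Gamma \<gamma> / (\<eta> * w / 2) powr \<gamma>"
      proof (rule divide_left_mono)
        have pos: "0 < \<eta> * w / 2" using \<open>w > 0\<close> assms(2) by simp
        show le: "(\<eta> * w / 2) powr \<gamma> \<le> (mu A - (b + 1)) powr \<gamma>"
          using mu(1)[OF A \<open>omega A > W0\<close>] pos \<open>\<gamma> > 0\<close> by (intro powr_mono2) (auto simp: w_def)
        have "0 < (\<eta> * w / 2) powr \<gamma>" using pos by (simp only: powr_gt_zero)
        then show "0 < (mu A - (b + 1)) powr \<gamma> * (\<eta> * w / 2) powr \<gamma>"
          using le by (intro mult_pos_pos) auto
        show "0 \<le> C * Gamma \<gamma>" using C(1) Gamma_real_pos[OF \<open>\<gamma> > 0\<close>] by simp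
      qed
      also have "\<dots> = \<epsilon> * Q * sin \<Delta> powr \<beta> * w powr (- \<gamma>)"
      proof -
        have "(\<eta> * w / 2) powr \<gamma> = (\<eta> / 2) powr \<gamma> * w powr \<gamma>"
          using \<open>w > 0\<close> assms(2) powr_mult[of "\<eta> / 2" w \<gamma>] by simp
        then show ?thesis using \<open>\<epsilon> > 0\<close> \<open>sin \<Delta> > 0\<close>
          by (simp add: Q_def powr_minus field_simps)
      qed
      also have "\<dots> \<le> \<epsilon> * w powr (1 / r) * sin \<Delta> powr \<beta> * w powr (- \<gamma>)"
        using Qw \<open>\<epsilon> > 0\<close> by (intro mult_right_mono mult_left_mono) auto
      also have "\<dots> = \<epsilon> * (w / sin \<Delta>) powr (- \<beta>)"
      proof -
        have "w powr (- \<gamma>) = w powr (- \<beta>) * w powr (- (1 / r))"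
          by (simp add: \<gamma> flip: powr_add)
        then show ?thesis
          using \<open>w > 0\<close> \<open>sin \<Delta> > 0\<close> by (simp add: powr_divide powr_minus field_simps)
      qed
      also have "\<dots> \<le> \<epsilon> * norm z powr (- \<beta>)"
        using \<open>\<epsilon> > 0\<close> \<open>norm z > 0\<close> \<open>\<beta> > 0\<close> z(4) \<open>sin \<Delta> > 0\<close>
        by (intro mult_left_mono powr_mono2') (auto simp: w_def field_simps)
      also have "\<dots> \<le> \<epsilon> * spectral_norm (mat_neg_power A \<beta>)"
        using mu(2)[OF A \<open>omega A > W0\<close>] assms(9) z \<open>\<epsilon> > 0\<close> \<open>\<beta> > 0\<close>
        by (intro mult_left_mono spectral_norm_mat_neg_power_ge) auto
      finally show ?thesis unfolding \<beta>_def .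
    qed
    show "\<exists>\<rho>>0. \<forall>A \<in> (admissible \<Delta> \<eta> :: (complex^'m^'m) set). spectral_norm (matrix_inv A) < \<rho> \<longrightarrow>
        spectral_norm (integral {0..} (F A)
           - (\<Sum>n=1..N. cscale (a n * of_real (Gamma (real n / r))) (mat_neg_power A (real n / r))))
          \<le> \<epsilon> * spectral_norm (mat_neg_power A (real N / r))"
      using main \<open>W > 0\<close> \<open>sin \<Delta> > 0\<close> by (intro exI[of _ "sin \<Delta> / W"]) auto
  qed
  ultimately show ?thesis unfolding F_def[abs_def] by blast
qed

end
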